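(* Let $\lambda>0$ and $\omega_F>0$, and consider the two linear difference equations on $\mathbb{R}$ $$\omega^+_{n+1}=\omega^+_n e^{-\lambda\pi/\omega_F}+\pi,\qquad \omega^-_{n+1}=(\pi+\omega^-_n)e^{-\lambda\pi/\omega_F},$$ with respective fixed points $$\bar\omega^+=\frac{\pi}{1-e^{-\lambda\pi/\omega_F}},\qquad \bar\omega^-=\frac{\pi}{e^{\lambda\pi/\omega_F}-1}.$$ The fixed points $\bar\omega^+$ and $\bar\omega^-$ are globally asymptotically stable and are such that $$\omega_F<\lambda\bar\omega^+<\omega_F+\lambda\pi\qquad\text{and}\qquad \omega_F-\lambda\pi<\lambda\bar\omega^-<\omega_F .$$ Moreover, if $\frac{\lambda\pi}{2\omega_F}\ll1$, the average $\tilde\omega=\frac{\bar\omega^++\bar\omega^-}{2}$ is $$\lambda\tilde\omega\simeq\omega_F+O\!\left(\frac{\lambda\pi}{2\omega_F}\right).$$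
   Context: The maps describe the change of the frequency variable $\omega$ of an adaptive frequency oscillator with input $F(t)=\cos(\omega_F t)$ over one slow-fast event (slow exponential decay at rate $\lambda$ for a time $\pi/\omega_F$, and an instantaneous increase by $\pi$). The condition $\frac{\lambda\pi}{2\omega_F}\ll1$ expresses a separation of time scales: $F(t)$ changes sign at a faster rate than the decay rate on the slow manifold. A fixed point of a map on $\mathbb{R}$ is globally asymptotically stable if it is Lyapunov stable and every orbit converges to it.
   Formalization: The error O(λπ/(2ω_F)) is proved with a constant depending on an arbitrary upper bound for λ, since it fails for unbounded λ (the error is about λπ/6 times the ratio); without a bound on λ, the relative form λω̃/ω_F = 1 + O(λπ/(2ω_F)) is proved. *)

theory Defs
  imports Complex_Main "HOL-Library.Landau_Symbols"
begin

definition lyapunov_stable :: "('a::metric_space \<Rightarrow> 'a) \<Rightarrow> 'a \<Rightarrow> bool" where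
  "lyapunov_stable f p \<longleftrightarrow>
     (\<forall>\<epsilon>>0. \<exists>\<delta>>0. \<forall>x. dist x p < \<delta> \<longrightarrow> (\<forall>n. dist ((f ^^ n) x) p < \<epsilon>))"

definition globally_asymptotically_stable :: "('a::metric_space \<Rightarrow> 'a) \<Rightarrow> 'a \<Rightarrow> bool" where
  "globally_asymptotically_stable f p \<longleftrightarrow>
     f p = p \<and> lyapunov_stable f p \<and> (\<forall>x. (\<lambda>n. (f ^^ n) x) \<longlonglongrightarrow> p)"

text \<open>
  Below \<open>l\<close> is the decay rate and \<open>w\<close> the input frequency. The maps \<open>map_plus l w\<close> and
  \<open>map_minus l w\<close> are the right-hand sides of the two difference equations, whose solutions
  are the orbits of these maps.
\<close>

definition map_plus :: "real \<Rightarrow> real \<Rightarrow> real \<Rightarrow> real" where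
  "map_plus l w x = x * exp (- (l * pi / w)) + pi"

definition map_minus :: "real \<Rightarrow> real \<Rightarrow> real \<Rightarrow> real" where
  "map_minus l w x = (pi + x) * exp (- (l * pi / w))"

definition fix_plus :: "real \<Rightarrow> real \<Rightarrow> real" where
  "fix_plus l w = pi / (1 - exp (- (l * pi / w)))"

definition fix_minus :: "real \<Rightarrow> real \<Rightarrow> real" where
  "fix_minus l w = pi / (exp (l * pi / w) - 1)"

definition fix_avg :: "real \<Rightarrow> real \<Rightarrow> real" where
  "fix_avg l w = (fix_plus l w + fix_minus l w) / 2"

definition time_ratio :: "real \<Rightarrow> real \<Rightarrow> real" where
  "time_ratio l w = l * pi / (2 * w)"

text \<open>
  The regime of small \<open>time_ratio l w\<close>: a property holds eventually iff it holds for all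
  positive \<open>l\<close>, \<open>w\<close> whose ratio is below some threshold. Both parameters vary jointly.
\<close>

definition time_scale_separation :: "(real \<times> real) filter" where
  "time_scale_separation =
     inf (filtercomap (\<lambda>(l, w). time_ratio l w) (at_right 0))
         (principal {(l, w). 0 < l \<and> 0 < w})"

text \<open>
  The same regime with \<open>l\<close> bounded by \<open>L\<close>. It covers both one-parameter limits: \<open>l\<close>
  tending to 0 with \<open>w\<close> fixed, and \<open>w\<close> tending to infinity with \<open>l\<close> fixed.
  The bound is needed for an absolute error \<open>O (time_ratio l w)\<close>: the difference
  \<open>l * fix_avg l w - w\<close> behaves like \<open>(pi / 6) * l * time_ratio l w\<close>, and \<open>l\<close> is
  unbounded in \<open>time_scale_separation\<close>.
\<close>

definition time_scale_separation_upto :: "real \<Rightarrow> (real \<times> real) filter" where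
  "time_scale_separation_upto L = inf time_scale_separation (principal {(l, w). l \<le> L})"

end

theory Submission
  imports Defs
begin

text \<open>
  Both maps contract distances to their fixed point by the factor \<open>exp (-t)\<close>, where
  \<open>t = l * pi / w\<close>. Moreover \<open>l * fix_minus l w = w * (t / (exp t - 1))\<close> and
  \<open>fix_plus l w = fix_minus l w + pi\<close>, so everything else reduces to bounds on the function
  \<open>t / (exp t - 1)\<close>: it lies between \<open>1 - t\<close> and \<open>1\<close>, which gives the
  inequalities and the relative error, and between \<open>1 - t/2\<close> and
  \<open>1 - t/2 + t\<^sup>2/2\<close>, which gives the absolute error.
\<close>

text \<open>Iteration gives the geometric bound \<open>a ^ n * dist x p\<close>. Since
  \<open>a ^ n\<close> is at most 1, stability holds with \<delta> equal to \<epsilon>; since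
  \<open>a ^ n\<close> tends to 0, every orbit converges.\<close>

lemma globally_asymptotically_stable_contraction:
  fixes f :: "'a::metric_space \<Rightarrow> 'a"
  assumes "0 \<le> a" "a < 1" and contr: "\<And>x. dist (f x) p \<le> a * dist x p"
  shows "globally_asymptotically_stable f p"
proof -
  have iter: "dist ((f ^^ n) x) p \<le> a ^ n * dist x p" for n x
  proof (induction n)
    case (Suc n)
    have "dist ((f ^^ Suc n) x) p \<le> a * dist ((f ^^ n) x) p"
      using contr by simp
    also have "\<dots> \<le> a * (a ^ n * dist x p)"
      using Suc \<open>0 \<le> a\<close> by (rule mult_left_mono)
    finally show ?case by (simp add: mult.assoc)
  qed simp
  have "f p = p"
    using contr[of p] by simp
  moreover have "lyapunov_stable f p"
    unfolding lyapunov_stable_def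
  proof (intro allI impI)
    fix e :: real assume "0 < e"
    have "dist ((f ^^ n) x) p < e" if "dist x p < e" for x n
    proof -
      have "a ^ n * dist x p \<le> 1 * dist x p"
        using assms by (intro mult_right_mono power_le_one) auto
      then show ?thesis
        using iter[of n x] that by linarith
    qed
    then show "\<exists>d>0. \<forall>x. dist x p < d \<longrightarrow> (\<forall>n. dist ((f ^^ n) x) p < e)"
      using \<open>0 < e\<close> by blast
  qed
  moreover have "(\<lambda>n. (f ^^ n) x) \<longlonglongrightarrow> p" for x
  proof -
    have "(\<lambda>n. a ^ n * dist x p) \<longlonglongrightarrow> 0 * dist x p"
      using assms by (intro tendsto_intros LIMSEQ_realpow_zero)
    then have lim: "(\<lambda>n. a ^ n * dist x p) \<longlonglongrightarrow> 0"
      by simp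
    have "(\<lambda>n. dist ((f ^^ n) x) p) \<longlonglongrightarrow> 0"
      by (rule tendsto_sandwich[OF _ _ tendsto_const lim]) (simp_all add: iter)
    then show ?thesis
      by (rule tendsto_dist_iff[THEN iffD2])
  qed
  ultimately show ?thesis
    unfolding globally_asymptotically_stable_def by blast
qed

text \<open>This is the [1/1] Pade bound for \<open>exp\<close>, multiplied out so that it also
  makes sense for \<open>t\<close> \<ge> 2. The difference of the sides vanishes at 0 and is
  nondecreasing because \<open>1 - x\<close> \<le> \<open>exp (- x)\<close>.\<close>

lemma pade_exp_le:
  fixes t :: real
  assumes "0 \<le> t"
  shows "(1 - t / 2) * exp t \<le> 1 + t / 2"
proof -
  let ?g = "\<lambda>t::real. 1 + t / 2 - (1 - t / 2) * exp t"
  have "?g 0 \<le> ?g t"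
  proof (rule DERIV_nonneg_imp_nondecreasing[OF assms])
    fix x :: real
    have "(?g has_real_derivative (1 - (1 - x) * exp x) / 2) (at x)"
      by (auto intro!: derivative_eq_intros simp: field_simps)
    moreover have "(1 - x) * exp x \<le> exp (- x) * exp x"
      using exp_ge_add_one_self[of "- x"] by (intro mult_right_mono) auto
    then have "0 \<le> (1 - (1 - x) * exp x) / 2"
      by (simp flip: exp_add)
    ultimately show "\<exists>y. (?g has_real_derivative y) (at x) \<and> 0 \<le> y"
      by blast
  qed
  then show ?thesis by simp
qed

text \<open>The expansion at 0 begins 1 - t/2 + t^2/12; the coefficient 1/2 in the last bound is
  generous but of the right order.\<close>

lemma div_exp_minus_1_bounds:
  fixes t :: real
  assumes "0 < t"
  shows "1 - t < t / (exp t - 1)" "t / (exp t - 1) < 1"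
    "1 - t / 2 \<le> t / (exp t - 1)" "t / (exp t - 1) \<le> 1 - t / 2 + t\<^sup>2 / 2"
proof -
  have quad: "t + t\<^sup>2 / 2 \<le> exp t - 1"
    using exp_lower_Taylor_quadratic[of t] assms by linarith
  have sq: "0 < t\<^sup>2" using assms by simp
  have pos: "0 < exp t - 1" using assms by simp
  have "t < exp t - 1"
    using quad sq by linarith
  then show "t / (exp t - 1) < 1"
    using pos by (simp only: divide_less_eq_1_pos)
  \<comment> \<open>Clearing the denominator turns this into exactly
    \<open>pade_exp_le\<close>.\<close>
  show half: "1 - t / 2 \<le> t / (exp t - 1)"
    using pade_exp_le[of t] assms pos
    by (simp add: pos_le_divide_eq left_diff_distrib right_diff_distrib)
  then show "1 - t < t / (exp t - 1)"
    using assms by linarith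
  \<comment> \<open>Completing the square gives the sign of the factor by which \<open>quad\<close>
    is then multiplied.\<close>
  have "t\<^sup>2 / 2 - t / 2 + 1 = ((t - 1 / 2)\<^sup>2 + 7 / 4) / 2"
    by (simp add: power2_eq_square field_simps)
  also have "\<dots> \<ge> 0" by simp
  finally have "(1 - t / 2 + t\<^sup>2 / 2) * (t + t\<^sup>2 / 2) \<le> (1 - t / 2 + t\<^sup>2 / 2) * (exp t - 1)"
    using quad by (intro mult_left_mono) auto
  \<comment> \<open>The quadratic terms cancel, so the product exceeds \<open>t\<close> by a
    nonnegative remainder.\<close>
  moreover have "(1 - t / 2 + t\<^sup>2 / 2) * (t + t\<^sup>2 / 2) = t + (t ^ 3 + t ^ 4) / 4"
    by (simp add: field_simps power2_eq_square power3_eq_cube power4_eq_xxxx)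
  moreover have "0 \<le> (t ^ 3 + t ^ 4) / 4"
    using assms by simp
  ultimately have "t \<le> (1 - t / 2 + t\<^sup>2 / 2) * (exp t - 1)"
    by linarith
  then show "t / (exp t - 1) \<le> 1 - t / 2 + t\<^sup>2 / 2"
    using pos by (simp add: divide_le_eq)
qed

context
  fixes l w :: real
  assumes l: "0 < l" and w: "0 < w"
begin

text \<open>The fixed points are the values of one periodic orbit just after and just before the
  jump by \<open>pi\<close>.\<close>

lemma fix_plus_eq: "fix_plus l w = fix_minus l w + pi"
proof -
  have "exp (l * pi / w) \<noteq> 1" using l w by simp
  then show ?thesis
    by (simp add: fix_plus_def fix_minus_def exp_minus divide_simps) (simp add: algebra_simps)
qed

lemma rate_fix_minus: "l * fix_minus l w = w * ((l * pi / w) / (exp (l * pi / w) - 1))"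
  using w by (simp add: fix_minus_def)

text \<open>This is the decay leg of the same orbit; with the jump \<open>fix_plus_eq\<close> it
  yields the fixed point equations of both maps.\<close>

lemma fix_minus_eq: "fix_minus l w = fix_plus l w * exp (- (l * pi / w))"
proof -
  have "exp (l * pi / w) \<noteq> 1" using l w by simp
  then show ?thesis
    by (simp add: fix_plus_def fix_minus_def exp_minus divide_simps)
qed

lemma globally_asymptotically_stable_map_plus:
  "globally_asymptotically_stable (map_plus l w) (fix_plus l w)"
proof (rule globally_asymptotically_stable_contraction[where a = "exp (- (l * pi / w))"])
  fix x
  \<comment> \<open>The map is affine, so deviations from its fixed point scale exactly by the
    slope.\<close>
  have "map_plus l w x - fix_plus l w = (x - fix_plus l w) * exp (- (l * pi / w))"
    using fix_plus_eq fix_minus_eq unfolding map_plus_def left_diff_distrib by linarith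
  then show "dist (map_plus l w x) (fix_plus l w) \<le> exp (- (l * pi / w)) * dist x (fix_plus l w)"
    by (simp add: dist_real_def abs_mult)
qed (use l w in auto)

lemma globally_asymptotically_stable_map_minus:
  "globally_asymptotically_stable (map_minus l w) (fix_minus l w)"
proof (rule globally_asymptotically_stable_contraction[where a = "exp (- (l * pi / w))"])
  fix x
  have "map_minus l w x - fix_minus l w = (x - fix_minus l w) * exp (- (l * pi / w))"
    using fix_minus_eq unfolding fix_plus_eq map_minus_def left_diff_distrib distrib_right
    by linarith
  then show "dist (map_minus l w x) (fix_minus l w) \<le> exp (- (l * pi / w)) * dist x (fix_minus l w)"
    by (simp add: dist_real_def abs_mult)
qed (use l w in auto)

lemma rate_fix_minus_bounds:
  "w - l * pi < l * fix_minus l w" "l * fix_minus l w < w"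
proof -
  have t: "0 < l * pi / w" using l w by simp
  show "w - l * pi < l * fix_minus l w"
    using mult_strict_left_mono[OF div_exp_minus_1_bounds(1)[OF t] w] w
    unfolding rate_fix_minus by (simp add: right_diff_distrib)
  show "l * fix_minus l w < w"
    using mult_strict_left_mono[OF div_exp_minus_1_bounds(2)[OF t] w]
    unfolding rate_fix_minus by simp
qed

lemma rate_fix_plus_bounds:
  "w < l * fix_plus l w" "l * fix_plus l w < w + l * pi"
  using rate_fix_minus_bounds by (simp_all add: fix_plus_eq distrib_left)

text \<open>With \<open>t = l * pi / w\<close>, the added term is \<open>w * t / 2\<close>. It
  cancels the linear term of \<open>w * (t / (exp t - 1))\<close>, which is why the average
  approximates \<open>w\<close> to second order in \<open>t\<close>.\<close>

lemma rate_fix_avg: "l * fix_avg l w = l * fix_minus l w + l * pi / 2"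
  by (simp add: fix_avg_def fix_plus_eq field_simps)

lemma abs_rate_fix_avg_diff_le: "\<bar>l * fix_avg l w - w\<bar> \<le> l * pi * time_ratio l w"
proof -
  define t where "t = l * pi / w"
  have t: "0 < t" and wt: "w * t = l * pi" using l w by (simp_all add: t_def)
  have "l * fix_avg l w - w = w * (t / (exp t - 1) - (1 - t / 2))"
    unfolding rate_fix_avg rate_fix_minus wt[symmetric] using w
    by (simp add: right_diff_distrib)
  also have "\<bar>\<dots>\<bar> = w * \<bar>t / (exp t - 1) - (1 - t / 2)\<bar>"
    using w by (simp add: abs_mult)
  \<comment> \<open>The two finer bounds place the difference between 0 and
    \<open>t\<^sup>2 / 2\<close>.\<close>
  also have "\<dots> \<le> w * (t\<^sup>2 / 2)"
    using div_exp_minus_1_bounds(3,4)[OF t] w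
    by (intro mult_left_mono abs_leI) linarith+
  also have "\<dots> = l * pi * time_ratio l w"
    using w by (simp add: time_ratio_def t_def power2_eq_square)
  finally show ?thesis .
qed

text \<open>Here the coarse bounds suffice: they confine \<open>l * fix_avg l w\<close> to within
  \<open>l * pi / 2\<close> of \<open>w\<close>, and dividing by \<open>w\<close> gives the
  ratio.\<close>

lemma abs_rate_fix_avg_ratio_le: "\<bar>l * fix_avg l w / w - 1\<bar> \<le> time_ratio l w"
proof -
  have "\<bar>l * fix_avg l w - w\<bar> \<le> l * pi / 2"
    using rate_fix_minus_bounds unfolding rate_fix_avg by linarith
  moreover have "l * fix_avg l w / w - 1 = (l * fix_avg l w - w) / w"
    using w by (simp add: diff_divide_distrib)
  ultimately show ?thesis
    using w by (simp add: time_ratio_def divide_simps)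
qed

lemma time_ratio_pos: "0 < time_ratio l w"
  using l w by (simp add: time_ratio_def)

end

lemma eventually_time_scale_separation:
  "eventually (\<lambda>(l, w). 0 < l \<and> 0 < w) time_scale_separation"
  unfolding time_scale_separation_def eventually_inf_principal
  by (rule always_eventually) auto

lemma eventually_time_scale_separation_upto:
  "eventually (\<lambda>(l, w). 0 < l \<and> 0 < w \<and> l \<le> L) (time_scale_separation_upto L)"
  unfolding time_scale_separation_upto_def eventually_inf_principal
  using eventually_time_scale_separation by eventually_elim auto

theorem lemma2p1:
  "(\<forall>l w::real. 0 < l \<longrightarrow> 0 < w \<longrightarrow>
      globally_asymptotically_stable (map_plus l w) (fix_plus l w) \<and>
      globally_asymptotically_stable (map_minus l w) (fix_minus l w) \<and>
      w < l * fix_plus l w \<and> l * fix_plus l w < w + l * pi \<and>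
      w - l * pi < l * fix_minus l w \<and> l * fix_minus l w < w) \<and>
   (\<forall>L>0. (\<lambda>(l, w). l * fix_avg l w - w)
      \<in> O[time_scale_separation_upto L](\<lambda>(l, w). time_ratio l w)) \<and>
   (\<lambda>(l, w). l * fix_avg l w / w - 1)
      \<in> O[time_scale_separation](\<lambda>(l, w). time_ratio l w)"
proof (intro conjI allI impI)
  fix L :: real
  show "(\<lambda>(l, w). l * fix_avg l w - w)
      \<in> O[time_scale_separation_upto L](\<lambda>(l, w). time_ratio l w)"
  \<comment> \<open>The pointwise bound has the factor \<open>l * pi\<close>, which \<open>l\<close>
    \<le> \<open>L\<close> makes uniform.\<close>
  proof (rule bigoI[where c = "L * pi"])
    show "eventually (\<lambda>x. norm (case x of (l, w) \<Rightarrow> l * fix_avg l w - w)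
        \<le> L * pi * norm (case x of (l, w) \<Rightarrow> time_ratio l w)) (time_scale_separation_upto L)"
      using eventually_time_scale_separation_upto[of L]
    proof (eventually_elim, clarify)
      fix l w :: real assume *: "0 < l" "0 < w" "l \<le> L"
      have "\<bar>l * fix_avg l w - w\<bar> \<le> l * pi * time_ratio l w"
        using * by (intro abs_rate_fix_avg_diff_le)
      also have "\<dots> \<le> L * pi * time_ratio l w"
        using * time_ratio_pos[of l w] by (intro mult_right_mono) auto
      finally show "norm (l * fix_avg l w - w) \<le> L * pi * norm (time_ratio l w)"
        using * time_ratio_pos[of l w] by simp
    qed
  qed
next
  show "(\<lambda>(l, w). l * fix_avg l w / w - 1)
      \<in> O[time_scale_separation](\<lambda>(l, w). time_ratio l w)"
  \<comment> \<open>The relative bound has constant 1 for every positive \<open>l\<close> and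
    \<open>w\<close>.\<close>
  proof (rule bigoI[where c = 1])
    show "eventually (\<lambda>x. norm (case x of (l, w) \<Rightarrow> l * fix_avg l w / w - 1)
        \<le> 1 * norm (case x of (l, w) \<Rightarrow> time_ratio l w)) time_scale_separation"
      using eventually_time_scale_separation
      by eventually_elim (auto intro: order_trans[OF abs_rate_fix_avg_ratio_le])
  qed
qed (fact globally_asymptotically_stable_map_plus globally_asymptotically_stable_map_minus
      rate_fix_plus_bounds rate_fix_minus_bounds)+

end
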